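(* Let $\mathcal{U}$ be a compact permutation invariant set satisfying Assumption 1. For $k=1,\dots,m$ let $\gamma(k)=\frac1k\max\{\sum_{i=1}^k h_i : h\in\mathcal{U}\}$, let $\gamma=\gamma(m)$, $$\beta=\max_{k=1,\dots,m}\frac{\gamma(k)}{\gamma+\frac1k},\qquad \hat{\mathcal{U}}=\beta\cdot\mathrm{conv}(e_1,\dots,e_m,\gamma e).$$ Let $(\hat x,\hat y(\hat h))$, $\hat h\in\hat{\mathcal{U}}$, be an optimal solution of $\Pi_{AR}(\hat{\mathcal{U}})$. Then the piecewise affine solution $$x=2\hat x,\qquad y(h)=\frac1\beta\sum_{i=1}^m(h_i-\beta\gamma)^+\,\hat y(\beta e_i)+\hat y(\beta\gamma e)\quad\text{for all }h\in\mathcal{U},$$ gives a $2\beta$-approximation for $\Pi_{AR}(\mathcal{U})$. Moreover, the set $2\cdot\hat{\mathcal{U}}$ dominates $\mathcal{U}$.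
   Context: Vector inequalities are componentwise; $e_i$ is the $i$-th standard basis vector and $e$ the all-ones vector of $\mathbb{R}^m$; $(a)^+=\max(a,0)$; $\mathrm{conv}$ denotes convex hull. Two-stage adjustable robust problem $\Pi_{AR}(\mathcal{S})$: the data are $A\in\mathbb{R}_+^{m\times n}$, $B\in\mathbb{R}^{m\times n}$, $c,d\in\mathbb{R}^n_+$. For a set $\mathcal{S}\subseteq\mathbb{R}^m_+$, a feasible solution is a pair $(x,y(\cdot))$ with $x\in\mathbb{R}^n_+$, $y:\mathcal{S}\to\mathbb{R}^n_+$ and $Ax+By(h)\ge h$ for all $h\in\mathcal{S}$; the optimal value $z_{AR}(\mathcal{S})$ is the minimum (infimum) over feasible solutions of the worst-case cost $c^Tx+\max_{h\in\mathcal{S}}d^Ty(h)$ (max read as supremum; value $+\infty$ if infeasible). An optimal solution is a feasible solution whose worst-case cost equals $z_{AR}(\mathcal{S})<\infty$. A solution $(x,y(\cdot))$ gives an $\alpha$-approximation for $\Pi_{AR}(\mathcal{U})$ if it is feasible for $\Pi_{AR}(\mathcal{U})$ and $c^Tx+d^Ty(h)\le\alpha\cdot z_{AR}(\mathcal{U})$ for all $h\in\mathcal{U}$. Assumption 1 on $\mathcal{U}$: $\mathcal{U}\subseteq[0,1]^m$ is convex, full-dimensional, $e_i\in\mathcal{U}$ for all $i=1,\dots,m$, and down-monotone, i.e. $h\in\mathcal{U}$ and $0\le h'\le h$ imply $h'\in\mathcal{U}$. $\mathcal{U}$ is permutation invariant if $x\in\mathcal{U}$ implies $x^\tau\in\mathcal{U}$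 for every permutation $\tau$ of $\{1,\dots,m\}$, where $x^\tau_i=x_{\tau(i)}$. Domination: $\hat{\mathcal{U}}\subseteq\mathbb{R}^m_+$ dominates $\mathcal{U}$ if for every $h\in\mathcal{U}$ there is $\hat h\in\hat{\mathcal{U}}$ with $\hat h\ge h$. *)

theory Defs
  imports "HOL-Analysis.Analysis"
begin

(* The order on real^'n is the componentwise one, 0 is the zero vector and 1 the all-ones
   vector e; axis i 1 is the standard basis vector e_i. A recourse policy on S is a total
   function of which only the values on S are ever used. *)

definition AR_feasible ::
  "real^'n^'m \<Rightarrow> real^'n^'m \<Rightarrow> (real^'m) set \<Rightarrow> real^'n \<Rightarrow> (real^'m \<Rightarrow> real^'n) \<Rightarrow> bool" where
  "AR_feasible A B S x y \<longleftrightarrow>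
     0 \<le> x \<and> (\<forall>h\<in>S. 0 \<le> y h \<and> h \<le> A *v x + B *v y h)"

definition AR_cost ::
  "real^'n \<Rightarrow> real^'n \<Rightarrow> (real^'m) set \<Rightarrow> real^'n \<Rightarrow> (real^'m \<Rightarrow> real^'n) \<Rightarrow> ereal" where
  "AR_cost c d S x y = ereal (c \<bullet> x) + (SUP h\<in>S. ereal (d \<bullet> y h))"

(* The infimum is taken in the extended reals, so an infeasible problem has value \<infinity>. *)
definition z_AR ::
  "real^'n^'m \<Rightarrow> real^'n^'m \<Rightarrow> real^'n \<Rightarrow> real^'n \<Rightarrow> (real^'m) set \<Rightarrow> ereal" where
  "z_AR A B c d S = Inf {AR_cost c d S x y |x y. AR_feasible A B S x y}"

definition AR_optimal ::
  "real^'n^'m \<Rightarrow> real^'n^'m \<Rightarrow> real^'n \<Rightarrow> real^'n \<Rightarrow> (real^'m) set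
    \<Rightarrow> real^'n \<Rightarrow> (real^'m \<Rightarrow> real^'n) \<Rightarrow> bool" where
  "AR_optimal A B c d S x y \<longleftrightarrow>
     AR_feasible A B S x y \<and> AR_cost c d S x y = z_AR A B c d S \<and> z_AR A B c d S < \<infinity>"

definition AR_approximation ::
  "real^'n^'m \<Rightarrow> real^'n^'m \<Rightarrow> real^'n \<Rightarrow> real^'n \<Rightarrow> (real^'m) set
    \<Rightarrow> real \<Rightarrow> real^'n \<Rightarrow> (real^'m \<Rightarrow> real^'n) \<Rightarrow> bool" where
  "AR_approximation A B c d U \<alpha> x y \<longleftrightarrow>
     AR_feasible A B U x y \<and>
     (\<forall>h\<in>U. ereal (c \<bullet> x + d \<bullet> y h) \<le> ereal \<alpha> * z_AR A B c d U)"

definition assumption1 :: "(real^'m) set \<Rightarrow> bool" where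
  "assumption1 U \<longleftrightarrow>
     U \<subseteq> {0..1} \<and> convex U \<and> aff_dim U = int CARD('m) \<and>
     (\<forall>i. axis i 1 \<in> U) \<and>
     (\<forall>h h'. h \<in> U \<and> 0 \<le> h' \<and> h' \<le> h \<longrightarrow> h' \<in> U)"

definition permutation_invariant :: "(real^'m) set \<Rightarrow> bool" where
  "permutation_invariant U \<longleftrightarrow> (\<forall>x\<in>U. \<forall>\<tau>. bij \<tau> \<longrightarrow> (\<chi> i. x $ \<tau> i) \<in> U)"

definition dominates :: "(real^'m) set \<Rightarrow> (real^'m) set \<Rightarrow> bool" where
  "dominates V U \<longleftrightarrow> (\<forall>v\<in>V. 0 \<le> v) \<and> (\<forall>h\<in>U. \<exists>v\<in>V. h \<le> v)"

(* The linear order identifies the finite index type 'm with {1,...,m}; first_indices k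
   corresponds to {1,...,k}. *)
definition first_indices :: "nat \<Rightarrow> 'm::{finite,linorder} set" where
  "first_indices k = {i. card {j. j \<le> i} \<le> k}"

(* For compact nonempty U the supremum is attained. *)
definition gamma_avg :: "(real^'m::{finite,linorder}) set \<Rightarrow> nat \<Rightarrow> real" where
  "gamma_avg U k = (1 / real k) * (SUP h\<in>U. \<Sum>i\<in>first_indices k. h $ i)"

definition beta_factor :: "(real^'m::{finite,linorder}) set \<Rightarrow> real" where
  "beta_factor U =
     (MAX k\<in>{1..CARD('m)}. gamma_avg U k / (gamma_avg U CARD('m) + 1 / real k))"

definition U_hat :: "(real^'m::{finite,linorder}) set \<Rightarrow> (real^'m::{finite,linorder}) set" where
  "U_hat U = (\<lambda>v. beta_factor U *\<^sub>R v) `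
     (convex hull (insert (gamma_avg U CARD('m) *\<^sub>R 1) (range (\<lambda>i. axis i 1))))"

end

theory Submission
  imports Defs
begin

text \<open>
  Permutation invariance turns \<open>k * \<gamma>(k)\<close> into a bound for the sum of any \<open>k\<close> coordinates of any
  \<open>h\<close> in \<open>U\<close>. Applied to the coordinates exceeding \<open>\<beta> * \<gamma>\<close>, together with
  \<open>\<gamma>(k) \<le> \<beta> * (\<gamma> + 1/k)\<close>, it shows that the excess \<open>\<Sum>i. (h i - \<beta> * \<gamma>)\<^sup>+\<close> is at most \<open>\<beta>\<close>.
  Hence \<open>h\<close> lies below \<open>\<beta>\<close> times the sum of \<open>\<gamma> e\<close> and a subconvex combination of the \<open>e\<^sub>i\<close>, which is
  the domination claim; the policy is the corresponding combination of the policies at these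
  points, of total weight at most 2. Averaging a maximiser over all permutations gives
  \<open>\<gamma> e \<in> U\<close>, so \<open>U_hat U \<subseteq> \<beta> U\<close>, and scaling solutions by \<open>\<beta>\<close> yields
  \<open>z_AR (U_hat U) \<le> \<beta> * z_AR U\<close>.
\<close>

section \<open>Coordinate sums under permutations\<close>

text \<open>The rank map \<open>r\<close> is strictly increasing, hence a bijection onto
  \<open>{1..CARD('m)}\<close>, and it carries \<open>first_indices k\<close> onto
  \<open>{1..k}\<close>.\<close>

lemma card_first_indices:
  assumes "k \<le> CARD('m::{finite,linorder})"
  shows "card (first_indices k :: 'm set) = k"
proof -
  define r where "r i = card {..i}" for i :: 'm
  have "r i < r j" if "i < j" for i j
    unfolding r_def using that by (intro psubset_card_mono) (auto simp: psubset_eq)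
  then have inj: "inj r"
    by (metis injI linorder_neqE less_irrefl)
  have sub: "range r \<subseteq> {1..CARD('m)}"
  proof -
    have "r i \<ge> 1" for i
      by (auto simp: r_def Suc_le_eq card_gt_0_iff)
    moreover have "r i \<le> CARD('m)" for i
      unfolding r_def by (intro card_mono) auto
    ultimately show ?thesis
      by (auto simp del: One_nat_def)
  qed
  have range: "range r = {1..CARD('m)}"
    by (rule card_subset_eq) (use sub inj in \<open>auto simp: card_image\<close>)
  have "r ` first_indices k = {1..k}"
  proof
    show "r ` first_indices k \<subseteq> {1..k}"
    proof
      fix l assume "l \<in> r ` first_indices k"
      then have "l \<in> range r" "l \<le> k"
        by (auto simp: first_indices_def r_def atMost_def)
      with sub show "l \<in> {1..k}"
        by (meson atLeastAtMost_iff subsetD)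
    qed
    show "{1..k} \<subseteq> r ` first_indices k"
    proof
      fix l assume l: "l \<in> {1..k}"
      then obtain i where "l = r i"
        using range assms by (metis (no_types) atLeastAtMost_iff imageE order_trans)
      with l show "l \<in> r ` first_indices k"
        by (auto simp: first_indices_def r_def atMost_def)
    qed
  qed
  moreover have "card (r ` first_indices k) = card (first_indices k :: 'm set)"
    by (rule card_image) (use inj in \<open>auto intro: inj_on_subset\<close>)
  ultimately show ?thesis
    by simp
qed

text \<open>The complements of \<open>I\<close> and \<open>J\<close> also have equal size, so a
  bijection between the sets and one between the complements glue to a permutation.\<close>

lemma bij_image_eq_exists:
  fixes I J :: "'a::finite set"
  assumes "card I = card J"
  obtains \<tau> where "bij \<tau>" "\<tau> ` I = J"
proof -
  obtain f where f: "bij_betw f I J"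
    using finite_same_card_bij[OF finite finite assms] ..
  have "card (- I) = card (- J)"
    using assms by (simp add: card_Diff_subset Compl_eq_Diff_UNIV)
  then obtain g where g: "bij_betw g (- I) (- J)"
    using finite_same_card_bij[OF finite finite] by blast
  define \<tau> where "\<tau> i = (if i \<in> I then f i else g i)" for i
  have I: "bij_betw \<tau> I J"
    using f by (subst bij_betw_cong[where g = f]) (auto simp: \<tau>_def)
  moreover have "bij_betw \<tau> (- I) (- J)"
    using g by (subst bij_betw_cong[where g = g]) (auto simp: \<tau>_def)
  ultimately have "bij_betw \<tau> (I \<union> - I) (J \<union> - J)"
    by (rule bij_betw_combine) auto
  then show thesis
    using I that by (simp add: bij_betw_def)
qed

text \<open>Permuting \<open>h\<close> so that the first \<open>card I\<close> positions read off
  the entries indexed by \<open>I\<close> stays in \<open>U\<close> and turns the sum into one of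
  those under the supremum in \<open>gamma_avg\<close>.\<close>

lemma sum_le_gamma_avg:
  fixes U :: "(real^'m::{finite,linorder}) set"
  assumes "U \<subseteq> {0..1}" "permutation_invariant U" "h \<in> U" "I \<noteq> {}"
  shows "(\<Sum>i\<in>I. h $ i) \<le> real (card I) * gamma_avg U (card I)"
proof -
  define F :: "'m set" where "F = first_indices (card I)"
  have "card F = card I"
    unfolding F_def by (intro card_first_indices card_mono) auto
  then obtain \<tau> where \<tau>: "bij \<tau>" "\<tau> ` F = I"
    using bij_image_eq_exists by metis
  define g where "g = (\<chi> i. h $ \<tau> i)"
  have "g \<in> U"
    using assms \<tau> by (simp add: g_def permutation_invariant_def)
  have "bdd_above ((\<lambda>h. \<Sum>i\<in>F. h $ i) ` U)"
  proof (rule bdd_aboveI2)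
    fix v assume "v \<in> U"
    then have "v $ i \<le> 1" for i
      using assms(1) by (auto simp: less_eq_vec_def)
    then show "(\<Sum>i\<in>F. v $ i) \<le> (\<Sum>i\<in>F. 1)"
      by (intro sum_mono) auto
  qed
  then have "(\<Sum>i\<in>F. g $ i) \<le> (SUP h\<in>U. \<Sum>i\<in>F. h $ i)"
    using \<open>g \<in> U\<close> by (intro cSUP_upper)
  also have "\<dots> = real (card I) * gamma_avg U (card I)"
    using assms(4) by (simp add: gamma_avg_def F_def)
  also have "(\<Sum>i\<in>F. g $ i) = (\<Sum>i\<in>I. h $ i)"
    unfolding \<tau>(2)[symmetric] using bij_is_inj[OF \<tau>(1)]
    by (subst sum.reindex) (auto simp: g_def intro: inj_on_subset)
  finally show ?thesis .
qed

section \<open>Positivity of \<gamma> and \<beta>, and the excess bound\<close>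

text \<open>A unit vector supported in a \<open>k\<close>-element set has coordinate sum 1 there,
  which forces \<open>k * gamma_avg U k\<close> to be at least 1.\<close>

lemma gamma_avg_pos:
  fixes U :: "(real^'m::{finite,linorder}) set"
  assumes "assumption1 U" "permutation_invariant U" "1 \<le> k" "k \<le> CARD('m)"
  shows "0 < gamma_avg U k"
proof -
  obtain I :: "'m set" where I: "card I = k"
    using card_first_indices assms(4) by blast
  with assms(3) obtain i where "i \<in> I"
    by fastforce
  have "U \<subseteq> {0..1}" "axis i 1 \<in> U"
    using assms(1) by (auto simp: assumption1_def)
  then have "(\<Sum>j\<in>I. axis i (1::real) $ j) \<le> real k * gamma_avg U k"
    using sum_le_gamma_avg[of U "axis i 1" I] assms(2) I \<open>i \<in> I\<close> by auto
  moreover have "(\<Sum>j\<in>I. axis i (1::real) $ j) = 1"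
    using \<open>i \<in> I\<close> by (simp add: axis_def)
  ultimately show ?thesis
    using assms(3) by (smt (verit) mult_nonneg_nonpos of_nat_0_le_iff)
qed

lemma beta_factor_ge:
  fixes U :: "(real^'m::{finite,linorder}) set"
  assumes "k \<in> {1..CARD('m)}"
  shows "gamma_avg U k / (gamma_avg U CARD('m) + 1 / real k) \<le> beta_factor U"
  unfolding beta_factor_def using assms by (intro Max_ge) auto

lemma beta_factor_pos:
  fixes U :: "(real^'m::{finite,linorder}) set"
  assumes "assumption1 U" "permutation_invariant U"
  shows "0 < beta_factor U"
proof -
  have m: "1 \<le> CARD('m)"
    by (simp add: Suc_leI)
  have "0 < gamma_avg U 1 / (gamma_avg U CARD('m) + 1 / real 1)"
    using gamma_avg_pos[OF assms, of 1] gamma_avg_pos[OF assms, of "CARD('m)"] m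
    by (intro divide_pos_pos) auto
  also have "\<dots> \<le> beta_factor U"
    using m by (intro beta_factor_ge) auto
  finally show ?thesis .
qed

lemma excess_le_beta_factor:
  fixes U :: "(real^'m::{finite,linorder}) set"
  assumes "assumption1 U" "permutation_invariant U" "h \<in> U"
  shows "(\<Sum>i\<in>UNIV. max (h $ i - beta_factor U * gamma_avg U CARD('m)) 0) \<le> beta_factor U"
proof -
  define \<beta> where "\<beta> = beta_factor U"
  define \<gamma> where "\<gamma> = gamma_avg U CARD('m)"
  define I where "I = {i. h $ i > \<beta> * \<gamma>}"
  have eq: "(\<Sum>i\<in>UNIV. max (h $ i - \<beta> * \<gamma>) 0) = (\<Sum>i\<in>I. h $ i - \<beta> * \<gamma>)"
    by (rule sum.mono_neutral_cong_right) (auto simp: I_def)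
  have "(\<Sum>i\<in>I. h $ i - \<beta> * \<gamma>) \<le> \<beta>"
  proof (cases "I = {}")
    case True
    then show ?thesis
      using beta_factor_pos[OF assms(1,2)] by (simp add: \<beta>_def)
  next
    case False
    define k where "k = card I"
    have k: "1 \<le> k" "k \<le> CARD('m)"
      using False by (auto simp: k_def Suc_le_eq card_gt_0_iff intro: card_mono)
    have "0 < \<gamma>"
      using gamma_avg_pos[OF assms(1,2), of "CARD('m)"] k by (simp add: \<gamma>_def)
    then have pos: "0 < \<gamma> + 1 / real k"
      using k by (intro add_pos_pos) auto
    have "U \<subseteq> {0..1}"
      using assms(1) by (simp add: assumption1_def)
    then have "(\<Sum>i\<in>I. h $ i) \<le> real k * gamma_avg U k"
      unfolding k_def using assms False by (intro sum_le_gamma_avg)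
    also have "gamma_avg U k \<le> \<beta> * (\<gamma> + 1 / real k)"
      using beta_factor_ge[of k U] k pos by (simp add: \<beta>_def \<gamma>_def divide_le_eq)
    \<comment> \<open>Multiplying by \<open>k\<close> turns the term \<open>1 / k\<close> into
      exactly one \<beta>; the rest is what subtracting the threshold at the \<open>k\<close>
      indices of \<open>I\<close> removes.\<close>
    also have "real k * (\<beta> * (\<gamma> + 1 / real k)) = real k * (\<beta> * \<gamma>) + \<beta>"
      using k by (simp add: field_simps)
    finally show ?thesis
      by (simp add: sum_subtractf k_def mult_left_mono)
  qed
  with eq show ?thesis
    by (simp add: \<beta>_def \<gamma>_def)
qed

section \<open>The constant point and the inclusion of \<open>U_hat U\<close> in the scaled
  set\<close>

lemma gamma_avg_one_mem:
  fixes U :: "(real^'m::{finite,linorder}) set"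
  assumes "compact U" "convex U" "U \<noteq> {}" "permutation_invariant U"
  shows "gamma_avg U CARD('m) *\<^sub>R 1 \<in> U"
proof -
  define s where "s h = (\<Sum>i\<in>UNIV. h $ i)" for h :: "(real, 'm) vec"
  define P where "P = {\<tau>::'m \<Rightarrow> 'm. bij \<tau>}"
  have "continuous_on U s"
    unfolding s_def by (intro continuous_intros)
  then obtain h where h: "h \<in> U" "\<forall>g\<in>U. s g \<le> s h"
    using continuous_attains_sup[OF assms(1,3)] by blast
  have "(SUP g\<in>U. s g) = s h"
    using h by (intro cSup_eq_maximum) auto
  moreover have "first_indices CARD('m) = (UNIV :: 'm set)"
    by (auto simp: first_indices_def intro: card_mono)
  ultimately have \<gamma>: "gamma_avg U CARD('m) = s h / CARD('m)"
    by (simp add: gamma_avg_def s_def)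
  have P: "finite P" "P \<noteq> {}"
    using bij_id by (auto simp: P_def)
  then have "card P > 0"
    by (simp add: card_gt_0_iff)
  \<comment> \<open>Composition with the transposition of \<open>i\<close> and \<open>j\<close> is
    an involution of \<open>P\<close> that matches the two families of summands.\<close>
  have const: "(\<Sum>\<tau>\<in>P. h $ \<tau> i) = (\<Sum>\<tau>\<in>P. h $ \<tau> j)" for i j
  proof (rule sum.reindex_bij_witness[where i = "\<lambda>\<tau>. \<tau> \<circ> Transposition.transpose i j"
        and j = "\<lambda>\<tau>. \<tau> \<circ> Transposition.transpose i j"])
  qed (auto simp: P_def comp_assoc intro: bij_comp)
  \<comment> \<open>Each permuted copy of \<open>h\<close> has total \<open>s h\<close>, so all
    copies together have total \<open>card P * s h\<close>, shared equally by the
    coordinates.\<close>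
  have avg: "(\<Sum>\<tau>\<in>P. h $ \<tau> i) = card P * (s h / CARD('m))" for i
  proof -
    have "CARD('m) * (\<Sum>\<tau>\<in>P. h $ \<tau> i) = (\<Sum>j\<in>UNIV. \<Sum>\<tau>\<in>P. h $ \<tau> j)"
    proof -
      have "(\<Sum>j\<in>UNIV. \<Sum>\<tau>\<in>P. h $ \<tau> j) = (\<Sum>j\<in>(UNIV :: 'm set). \<Sum>\<tau>\<in>P. h $ \<tau> i)"
        by (intro sum.cong refl const)
      then show ?thesis
        by simp
    qed
    also have "\<dots> = (\<Sum>\<tau>\<in>P. \<Sum>j\<in>UNIV. h $ \<tau> j)"
      by (rule sum.swap)
    also have "\<dots> = (\<Sum>\<tau>\<in>P. s h)"
      by (intro sum.cong) (auto simp: P_def s_def intro: sum.reindex_bij_betw)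
    finally show ?thesis
      by (simp add: field_simps)
  qed
  have "(\<Sum>\<tau>\<in>P. (1 / card P) *\<^sub>R (\<chi> i. h $ \<tau> i)) \<in> U"
    using P \<open>card P > 0\<close> h(1) assms(2,4)
    by (intro convex_sum) (auto simp: P_def permutation_invariant_def)
  also have "(\<Sum>\<tau>\<in>P. (1 / card P) *\<^sub>R (\<chi> i. h $ \<tau> i)) = gamma_avg U CARD('m) *\<^sub>R 1"
    using \<open>card P > 0\<close> P by (simp add: vec_eq_iff avg \<gamma> flip: sum_divide_distrib)
  finally show ?thesis .
qed

lemma U_hat_subset:
  fixes U :: "(real^'m::{finite,linorder}) set"
  assumes "compact U" "permutation_invariant U" "assumption1 U"
  shows "U_hat U \<subseteq> (\<lambda>v. beta_factor U *\<^sub>R v) ` U"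
proof -
  have "convex U" and ax: "axis i 1 \<in> U" for i
    using assms(3) by (auto simp: assumption1_def)
  then have "gamma_avg U CARD('m) *\<^sub>R 1 \<in> U"
    using gamma_avg_one_mem[OF assms(1)] assms(2) by blast
  then have "convex hull (insert (gamma_avg U CARD('m) *\<^sub>R 1) (range (\<lambda>i. axis i 1))) \<subseteq> U"
    using ax \<open>convex U\<close> by (intro hull_minimal) auto
  then show ?thesis
    unfolding U_hat_def by (rule image_mono)
qed

section \<open>Costs, optimal values and scaling\<close>

text \<open>This trades the extended-real supremum for pointwise real inequalities, the form in
  which costs are handled below.\<close>

lemma AR_cost_le_iff:
  assumes "S \<noteq> {}"
  shows "AR_cost c d S x y \<le> ereal q \<longleftrightarrow> (\<forall>h\<in>S. c \<bullet> x + d \<bullet> y h \<le> q)"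
proof -
  have "AR_cost c d S x y \<le> ereal q \<longleftrightarrow> (SUP h\<in>S. ereal (d \<bullet> y h)) \<le> ereal (q - c \<bullet> x)"
    unfolding AR_cost_def
    by (cases "SUP h\<in>S. ereal (d \<bullet> y h)") auto
  also have "\<dots> \<longleftrightarrow> (\<forall>h\<in>S. c \<bullet> x + d \<bullet> y h \<le> q)"
    unfolding SUP_le_iff by (auto simp: algebra_simps)
  finally show ?thesis .
qed

text \<open>The constraint is homogeneous in \<open>x\<close>, \<open>y\<close> and \<open>h\<close>
  jointly, so \<beta> times a solution on \<open>S\<close> serves every point of \<beta> times
  \<open>S\<close>, in particular those in \<open>V\<close>.\<close>

lemma AR_feasible_scale:
  assumes "0 < \<beta>" "V \<subseteq> (\<lambda>v. \<beta> *\<^sub>R v) ` S" "AR_feasible A B S x y"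
  shows "AR_feasible A B V (\<beta> *\<^sub>R x) (\<lambda>h. \<beta> *\<^sub>R y ((1 / \<beta>) *\<^sub>R h))"
  unfolding AR_feasible_def
proof (intro conjI ballI)
  show "0 \<le> \<beta> *\<^sub>R x"
    using assms by (simp add: AR_feasible_def less_eq_vec_def)
  fix h assume "h \<in> V"
  then obtain g where g: "g \<in> S" "h = \<beta> *\<^sub>R g"
    using assms(2) by auto
  then have y: "0 \<le> y g" "g \<le> A *v x + B *v y g"
    using assms(3) by (auto simp: AR_feasible_def)
  show "0 \<le> \<beta> *\<^sub>R y ((1 / \<beta>) *\<^sub>R h)"
    using y(1) g(2) assms(1) by (simp add: less_eq_vec_def)
  have "\<beta> *\<^sub>R g \<le> \<beta> *\<^sub>R (A *v x + B *v y g)"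
    using y(2) assms(1) by (simp add: less_eq_vec_def mult_left_mono)
  then show "h \<le> A *v (\<beta> *\<^sub>R x) + B *v (\<beta> *\<^sub>R y ((1 / \<beta>) *\<^sub>R h))"
    using g(2) assms(1) by (simp add: matrix_vector_mult_scaleR scaleR_add_right)
qed

text \<open>Scaling a feasible solution by \<beta> scales its cost at each point by \<beta>; passing
  to the subset \<open>V\<close> can only lower the worst case.\<close>

lemma z_AR_scale_le:
  assumes "0 < \<beta>" "V \<noteq> {}" "V \<subseteq> (\<lambda>v. \<beta> *\<^sub>R v) ` S"
  shows "z_AR A B c d V \<le> ereal \<beta> * z_AR A B c d S"
proof -
  have "z_AR A B c d V \<le> ereal \<beta> * AR_cost c d S x y" if feas: "AR_feasible A B S x y" for x y
  proof -
    define x' where "x' = \<beta> *\<^sub>R x"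
    define y' where "y' = (\<lambda>h. \<beta> *\<^sub>R y ((1 / \<beta>) *\<^sub>R h))"
    have "z_AR A B c d V \<le> AR_cost c d V x' y'"
      unfolding z_AR_def x'_def y'_def
      using AR_feasible_scale[OF assms(1,3) feas] by (intro Inf_lower) blast
    also have "\<dots> \<le> ereal \<beta> * AR_cost c d S x y"
    proof -
      have "S \<noteq> {}"
        using assms by auto
      have *: "AR_cost c d V x' y' \<le> ereal (\<beta> * q)" if "AR_cost c d S x y \<le> ereal q" for q
        unfolding AR_cost_le_iff[OF assms(2)]
      proof
        fix h assume "h \<in> V"
        then obtain g where g: "g \<in> S" "h = \<beta> *\<^sub>R g"
          using assms(3) by auto
        then have "c \<bullet> x + d \<bullet> y g \<le> q"
          using that AR_cost_le_iff[OF \<open>S \<noteq> {}\<close>] by blast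
        then have "\<beta> * (c \<bullet> x + d \<bullet> y g) \<le> \<beta> * q"
          using assms(1) by (simp add: mult_left_mono)
        then show "c \<bullet> x' + d \<bullet> y' h \<le> \<beta> * q"
          using g(2) assms(1) by (simp add: x'_def y'_def algebra_simps)
      qed
      show ?thesis
      proof (cases "AR_cost c d S x y")
        case (real q)
        with *[of q] show ?thesis
          by simp
      next
        case PInf
        with assms(1) show ?thesis
          by simp
      next
        \<comment> \<open>This case is contradictory: the cost at any single point of
          \<open>S\<close> is a real lower bound.\<close>
        case MInf
        obtain g where "g \<in> S"
          using \<open>S \<noteq> {}\<close> by blast
        moreover have "AR_cost c d S x y \<le> ereal (c \<bullet> x + d \<bullet> y g - 1)"
          using MInf by simp
        ultimately have "c \<bullet> x + d \<bullet> y g \<le> c \<bullet> x + d \<bullet> y g - 1"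
          using AR_cost_le_iff[OF \<open>S \<noteq> {}\<close>] by blast
        then show ?thesis
          by simp
      qed
    qed
    finally show ?thesis .
  qed
  then have "z_AR A B c d V \<le>
      Inf {ereal \<beta> * t |t. \<exists>x y. t = AR_cost c d S x y \<and> AR_feasible A B S x y}"
    by (intro Inf_greatest) auto
  also have "\<dots> = ereal \<beta> * z_AR A B c d S"
    unfolding z_AR_def by (subst ereal_Inf_cmult[OF assms(1)]) simp
  finally show ?thesis .
qed

text \<open>Optimality excludes the value \<infinity>, and the real cost at one point of
  \<open>S\<close> excludes -\<infinity>.\<close>

lemma AR_optimal_value_real:
  assumes "AR_optimal A B c d S x y" "S \<noteq> {}"
  obtains r where "z_AR A B c d S = ereal r" "\<And>h. h \<in> S \<Longrightarrow> c \<bullet> x + d \<bullet> y h \<le> r"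
proof -
  have cost: "AR_cost c d S x y = z_AR A B c d S" "z_AR A B c d S < \<infinity>"
    using assms(1) by (auto simp: AR_optimal_def)
  obtain h where "h \<in> S"
    using assms(2) by blast
  then have "\<not> AR_cost c d S x y \<le> ereal (c \<bullet> x + d \<bullet> y h - 1)"
    unfolding AR_cost_le_iff[OF assms(2)] by force
  with cost obtain r where r: "z_AR A B c d S = ereal r"
    by (cases "z_AR A B c d S") auto
  then have "AR_cost c d S x y \<le> ereal r"
    using cost by simp
  with r that show thesis
    using AR_cost_le_iff[OF assms(2)] by blast
qed

theorem theorem3p5:
  fixes A B :: "real^'n^'m::{finite,linorder}"
    and c d :: "real^'n"
    and U :: "(real^'m::{finite,linorder}) set"
    and \<gamma> \<beta> :: real
    and x_hat :: "real^'n"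
    and y_hat :: "real^'m::{finite,linorder} \<Rightarrow> real^'n"
  assumes "\<forall>i j. 0 \<le> A $ i $ j"
    and "0 \<le> c" and "0 \<le> d"
    and "compact U"
    and "permutation_invariant U"
    and "assumption1 U"
    and "\<gamma> = gamma_avg U CARD('m)"
    and "\<beta> = beta_factor U"
  shows "(AR_optimal A B c d (U_hat U) x_hat y_hat \<longrightarrow>
          AR_approximation A B c d U (2 * \<beta>)
           (2 *\<^sub>R x_hat)
           (\<lambda>h. (1 / \<beta>) *\<^sub>R (\<Sum>i\<in>UNIV. max (h $ i - \<beta> * \<gamma>) 0 *\<^sub>R y_hat (\<beta> *\<^sub>R axis i 1))
                  + y_hat ((\<beta> * \<gamma>) *\<^sub>R 1))) \<and>
         dominates ((\<lambda>v. 2 *\<^sub>R v) ` U_hat U) U"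
proof -
  \<comment> \<open>\<open>\<Lambda> h i\<close> is the weight of the policy at
    \<open>\<beta> *\<^sub>R axis i 1\<close>; dividing the excess by \<beta> makes the weights of a
    point of \<open>U\<close> sum to at most 1.\<close>
  define \<Lambda> where "\<Lambda> h i = (1 / \<beta>) * max (h $ i - \<beta> * \<gamma>) 0" for h :: "(real, 'm) vec" and i
  define H where "H = convex hull (insert (\<gamma> *\<^sub>R (1 :: (real, 'm) vec)) (range (\<lambda>i. axis i 1)))"
  have \<beta>: "0 < \<beta>"
    using beta_factor_pos assms by blast
  have "1 \<le> CARD('m)"
    by (simp add: Suc_leI)
  then have \<gamma>: "0 < \<gamma>"
    using gamma_avg_pos[OF assms(6,5), of "CARD('m)"] assms(7) by simp
  have U_hat: "U_hat U = (\<lambda>v. \<beta> *\<^sub>R v) ` H"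
    by (simp add: U_hat_def H_def assms(7,8))
  have H: "\<gamma> *\<^sub>R 1 \<in> H" "axis i 1 \<in> H" for i
    by (auto simp: H_def intro: hull_inc)
  have nonneg: "0 \<le> \<Lambda> h i" for h i
    using \<beta> by (simp add: \<Lambda>_def)
  have weight: "(\<Sum>i\<in>UNIV. \<Lambda> h i) \<le> 1" if "h \<in> U" for h
    using excess_le_beta_factor[OF assms(6,5) that] \<beta> assms(7,8)
    by (simp add: \<Lambda>_def divide_le_eq flip: sum_divide_distrib)
  have below: "h $ i \<le> \<beta> * \<gamma> + \<beta> * \<Lambda> h i" for h i
    using \<beta> by (simp add: \<Lambda>_def)

  \<comment> \<open>Domination\<close>
  have "dominates ((\<lambda>v. 2 *\<^sub>R v) ` U_hat U) U"
    unfolding dominates_def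
  proof (intro conjI ballI)
    have "convex {v::(real, 'm) vec. 0 \<le> v}"
      by (auto simp: convex_def less_eq_vec_def)
    then have "H \<subseteq> {v. 0 \<le> v}"
      unfolding H_def using \<gamma> by (intro hull_minimal) (auto simp: less_eq_vec_def axis_def)
    then show "0 \<le> v" if "v \<in> (\<lambda>v. 2 *\<^sub>R v) ` U_hat U" for v
      using that \<beta> by (auto simp: U_hat less_eq_vec_def)
  next
    fix h assume "h \<in> U"
    \<comment> \<open>Any index will do: it absorbs the missing weight \<open>1 - s\<close>, making
      \<open>w\<close> a genuine convex combination that is still at least
      \<open>\<Lambda> h i\<close> in every coordinate.\<close>
    define j :: 'm where "j = undefined"
    define s where "s = (\<Sum>i\<in>UNIV. \<Lambda> h i)"
    define w where "w = (\<Sum>i\<in>UNIV. (\<Lambda> h i + (if i = j then 1 - s else 0)) *\<^sub>R axis i (1::real))"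
    have "s \<le> 1"
      using weight[OF \<open>h \<in> U\<close>] by (simp add: s_def)
    have "convex H"
      by (simp add: H_def)
    have "w \<in> H"
      unfolding w_def using \<open>convex H\<close> H \<open>s \<le> 1\<close> nonneg
      by (intro convex_sum) (auto simp: sum.distrib s_def)
    \<comment> \<open>The midpoint keeps the vector in \<open>H\<close>; the factor 2 undoes the
      halves, so \<open>v\<close> is \<beta> times the sum of \<gamma> e and
      \<open>w\<close>.\<close>
    define v where "v = 2 *\<^sub>R \<beta> *\<^sub>R ((1 / 2) *\<^sub>R \<gamma> *\<^sub>R (1 :: (real, 'm) vec) + (1 / 2) *\<^sub>R w)"
    have "(1 / 2) *\<^sub>R \<gamma> *\<^sub>R 1 + (1 / 2) *\<^sub>R w \<in> H"
      using \<open>w \<in> H\<close> H by (intro convexD[OF \<open>convex H\<close>]) auto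
    then have "v \<in> (\<lambda>v. 2 *\<^sub>R v) ` U_hat U"
      unfolding v_def U_hat by blast
    moreover have "h \<le> v"
      unfolding less_eq_vec_def
    proof
      fix i
      have "\<Lambda> h i \<le> w $ i"
        using \<open>s \<le> 1\<close> by (simp add: w_def axis_def if_distrib[of "(*) _"] cong: if_cong)
      then have "\<beta> * \<Lambda> h i \<le> \<beta> * w $ i"
        using \<beta> by simp
      with below[of h i] show "h $ i \<le> v $ i"
        by (simp add: v_def algebra_simps)
    qed
    ultimately show "\<exists>v\<in>(\<lambda>v. 2 *\<^sub>R v) ` U_hat U. h \<le> v"
      by (rule bexI[rotated])
  qed

  \<comment> \<open>Feasibility and cost of the piecewise affine policy\<close>
  moreover have "AR_approximation A B c d U (2 * \<beta>) (2 *\<^sub>R x_hat)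
           (\<lambda>h. (1 / \<beta>) *\<^sub>R (\<Sum>i\<in>UNIV. max (h $ i - \<beta> * \<gamma>) 0 *\<^sub>R y_hat (\<beta> *\<^sub>R axis i 1))
                  + y_hat ((\<beta> * \<gamma>) *\<^sub>R 1))"
    if opt: "AR_optimal A B c d (U_hat U) x_hat y_hat"
  proof -
    define Y where "Y i = y_hat (\<beta> *\<^sub>R axis i 1)" for i :: 'm
    define Y0 where "Y0 = y_hat ((\<beta> * \<gamma>) *\<^sub>R 1)"
    have mem: "\<beta> *\<^sub>R axis i 1 \<in> U_hat U" "(\<beta> * \<gamma>) *\<^sub>R 1 \<in> U_hat U" for i
      using H by (auto simp: U_hat simp flip: scaleR_scaleR)
    have feas: "AR_feasible A B (U_hat U) x_hat y_hat"
      using opt by (simp add: AR_optimal_def)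
    then have x: "0 \<le> x_hat" and Y: "0 \<le> Y i" "\<beta> *\<^sub>R axis i 1 \<le> A *v x_hat + B *v Y i"
      and Y0: "0 \<le> Y0" "(\<beta> * \<gamma>) *\<^sub>R 1 \<le> A *v x_hat + B *v Y0" for i
      using mem by (auto simp: AR_feasible_def Y_def Y0_def)
    \<comment> \<open>Nonnegativity of \<open>A\<close> enters here: the weighted constraints use
      \<open>s\<close> copies of \<open>A *v x_hat\<close> with \<open>s \<le> 1\<close>, and one
      full copy then covers them.\<close>
    have Ax: "0 \<le> (A *v x_hat) $ i" for i
      using assms(1) x by (auto simp: matrix_vector_mult_def less_eq_vec_def intro!: sum_nonneg)
    have policy: "(\<lambda>h. (1 / \<beta>) *\<^sub>R (\<Sum>i\<in>UNIV. max (h $ i - \<beta> * \<gamma>) 0 *\<^sub>R y_hat (\<beta> *\<^sub>R axis i 1))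
                  + y_hat ((\<beta> * \<gamma>) *\<^sub>R 1)) = (\<lambda>h. (\<Sum>i\<in>UNIV. \<Lambda> h i *\<^sub>R Y i) + Y0)"
      by (simp add: \<Lambda>_def Y_def Y0_def scaleR_sum_right)
    obtain r where r: "z_AR A B c d (U_hat U) = ereal r"
      and cost: "\<And>h. h \<in> U_hat U \<Longrightarrow> c \<bullet> x_hat + d \<bullet> y_hat h \<le> r"
      using AR_optimal_value_real[OF opt] mem by blast
    have costs: "c \<bullet> x_hat + d \<bullet> Y i \<le> r" "c \<bullet> x_hat + d \<bullet> Y0 \<le> r" for i
      using cost mem by (auto simp: Y_def Y0_def)
    have dY: "0 \<le> d \<bullet> Y i" for i
      using assms(3) Y(1)[of i]
      by (auto simp: inner_vec_def less_eq_vec_def intro!: sum_nonneg)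
    show ?thesis
      unfolding policy AR_approximation_def AR_feasible_def
    proof (intro conjI ballI)
      show "0 \<le> 2 *\<^sub>R x_hat"
        using x by (simp add: less_eq_vec_def)
    next
      fix h assume "h \<in> U"
      show "0 \<le> (\<Sum>i\<in>UNIV. \<Lambda> h i *\<^sub>R Y i) + Y0"
        using Y(1) Y0(1) nonneg
        by (auto simp: less_eq_vec_def intro!: add_nonneg_nonneg sum_nonneg)
    next
      fix h assume "h \<in> U"
      define s where "s = (\<Sum>i\<in>UNIV. \<Lambda> h i)"
      have "h $ j \<le> (A *v (2 *\<^sub>R x_hat) + B *v ((\<Sum>i\<in>UNIV. \<Lambda> h i *\<^sub>R Y i) + Y0)) $ j" for j
      proof -
        define a where "a = (A *v x_hat) $ j"
        define b where "b i = (B *v Y i) $ j" for i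
        have "\<beta> * axis i 1 $ j \<le> a + b i" for i
          using Y(2)[of i] by (simp add: a_def b_def less_eq_vec_def)
        \<comment> \<open>The constraints at the points \<beta> e_i are combined with weights
          \<open>\<Lambda> h i\<close>; in row \<open>j\<close> only the term \<open>i = j\<close>
          survives on the left.\<close>
        then have "(\<Sum>i\<in>UNIV. \<Lambda> h i * (\<beta> * axis i 1 $ j)) \<le> (\<Sum>i\<in>UNIV. \<Lambda> h i * (a + b i))"
          using nonneg by (intro sum_mono mult_left_mono)
        then have "\<beta> * \<Lambda> h j \<le> s * a + (\<Sum>i\<in>UNIV. \<Lambda> h i * b i)"
          by (simp add: s_def axis_def distrib_left sum.distrib sum_distrib_left
              if_distrib[of "(*) _"] mult.commute cong: if_cong)
        moreover have "s * a \<le> a"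
          using weight[OF \<open>h \<in> U\<close>] Ax[of j] by (simp add: s_def a_def mult_left_le_one_le
              sum_nonneg nonneg)
        moreover have "\<beta> * \<gamma> \<le> a + (B *v Y0) $ j"
          using Y0(2) by (simp add: a_def less_eq_vec_def)
        moreover have "(B *v (\<Sum>i\<in>UNIV. \<Lambda> h i *\<^sub>R Y i)) $ j = (\<Sum>i\<in>UNIV. \<Lambda> h i * b i)"
          by (simp add: linear_sum[OF matrix_vector_mul_linear] matrix_vector_mult_scaleR b_def)
        \<comment> \<open>One copy of \<open>a\<close> pays for the excess part and one for the
          constant part \<beta> \<gamma>, which is why the first stage is doubled.\<close>
        ultimately show ?thesis
          using below[of h j]
          by (simp add: matrix_vector_right_distrib matrix_vector_mult_scaleR a_def)
      qed
      then show "h \<le> A *v (2 *\<^sub>R x_hat) + B *v ((\<Sum>i\<in>UNIV. \<Lambda> h i *\<^sub>R Y i) + Y0)"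
        by (simp add: less_eq_vec_def)
    next
      fix h assume "h \<in> U"
      \<comment> \<open>\<open>K\<close> is the recourse budget left by the optimal value. It is
        nonnegative because \<open>d \<bullet> Y i\<close> is, so weights with sum at most 1 cost at
        most \<open>K\<close>; the constant part costs at most another \<open>K\<close>, which gives
        \<open>2 * r\<close> in total.\<close>
      define K where "K = r - c \<bullet> x_hat"
      have K: "0 \<le> K" "d \<bullet> Y i \<le> K" for i
        using costs(1)[of i] dY[of i] by (auto simp: K_def)
      have "d \<bullet> (\<Sum>i\<in>UNIV. \<Lambda> h i *\<^sub>R Y i) = (\<Sum>i\<in>UNIV. \<Lambda> h i * (d \<bullet> Y i))"
        by (simp add: inner_sum_right)
      also have "\<dots> \<le> (\<Sum>i\<in>UNIV. \<Lambda> h i * K)"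
        using K(2) nonneg by (intro sum_mono mult_left_mono)
      also have "\<dots> \<le> K"
        using weight[OF \<open>h \<in> U\<close>] K(1)
        by (simp add: mult_left_le_one_le sum_nonneg nonneg flip: sum_distrib_right)
      finally have "c \<bullet> (2 *\<^sub>R x_hat) + d \<bullet> ((\<Sum>i\<in>UNIV. \<Lambda> h i *\<^sub>R Y i) + Y0) \<le> 2 * r"
        using costs(2) by (simp add: K_def inner_add_right)
      also have "ereal (2 * r) = ereal 2 * z_AR A B c d (U_hat U)"
        by (simp add: r)
      also have "\<dots> \<le> ereal 2 * (ereal \<beta> * z_AR A B c d U)"
        using mem U_hat_subset[OF assms(4-6)] \<beta> assms(8)
        by (intro ereal_mult_left_mono z_AR_scale_le) auto
      also have "\<dots> = ereal (2 * \<beta>) * z_AR A B c d U"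
        by (simp add: mult.assoc[symmetric])
      finally show "ereal (c \<bullet> (2 *\<^sub>R x_hat) + d \<bullet> ((\<Sum>i\<in>UNIV. \<Lambda> h i *\<^sub>R Y i) + Y0))
          \<le> ereal (2 * \<beta>) * z_AR A B c d U"
        by simp
    qed
  qed
  ultimately show ?thesis
    by blast
qed

end
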